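(* Let $0<r<1$, let $D(0,r,1)=\{z\in\mathbb{C}:r<|z|<1\}$, and let $\phi:\overline{D(0,r,1)}\to\mathbb{C}$ be continuous and injective on $\overline{D(0,r,1)}$ and holomorphic on $D(0,r,1)$. Assume that $\phi'$ has a continuous extension to $\overline{D(0,r,1)}$. Set $\gamma(e^{i\theta}):=\phi(e^{i\theta})$ for $\theta\in\mathbb{R}$, and let $W$ be the interior of the Jordan curve $\gamma$. Assume that $\phi(D(0,r,1))\subseteq W$. Let $D=D(0,1)$ be the open unit disk, let $F:D\to W$ be a conformal mapping of $D$ onto $W$, and denote also by $F:\overline{D}\to\overline{W}$ its extension to a homeomorphism. Then: 1. The function $F'$ extends continuously to $\overline{D}$. 2. If $\phi'(z)\neq 0$ for some $z$ with $|z|=1$, then $F'(\zeta)\neq 0$ for $\zeta$ such that $(\phi^{-1}\circ F)(\zeta)=z$. (Here $\phi'$ and $F'$ at points of the unit circle denote the values of the continuous extensions.)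
   Context: The interior of a Jordan curve is the bounded connected component of its complement in $\mathbb{C}$. A conformal mapping is an injective holomorphic map. The homeomorphic extension of $F$ to the closed disk exists by the Osgood–Carathéodory theorem. *)

theory Defs
  imports "HOL-Complex_Analysis.Complex_Analysis"
begin

definition annulus :: "complex \<Rightarrow> real \<Rightarrow> real \<Rightarrow> complex set" where
  "annulus c r s = {z. r < dist c z \<and> dist c z < s}"

(* On the closure of S the extension g is uniquely determined by f,
   so "the value of the extension of f at z" is g z for any such g. *)
definition continuous_extension :: "complex set \<Rightarrow> (complex \<Rightarrow> complex) \<Rightarrow> (complex \<Rightarrow> complex) \<Rightarrow> bool" where
  "continuous_extension S f g \<longleftrightarrow> continuous_on (closure S) g \<and> (\<forall>z\<in>S. g z = f z)"

definition is_conformal_onto :: "(complex \<Rightarrow> complex) \<Rightarrow> complex set \<Rightarrow> complex set \<Rightarrow> bool" where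
  "is_conformal_onto f S T \<longleftrightarrow> f holomorphic_on S \<and> inj_on f S \<and> f ` S = T"

(* Meant for the trace J of a Jordan curve, whose complement has exactly one
   bounded component. *)
definition is_interior_of :: "complex set \<Rightarrow> complex set \<Rightarrow> bool" where
  "is_interior_of W J \<longleftrightarrow> W \<in> components (- J) \<and> bounded W"

end

(* Put h = phi^-1 o F, so F = phi o h near the unit circle. An open-closed argument shows that h is
   defined on some annulus rho < |z| <= 1: in W minus the phi-image of the circle |z| = r,
   the image of the annulus is relatively clopen, so its F-preimage contains a full collar of the
   unit circle. There h is injective and maps the circle to the circle, so reflection extends
   it to an injective holomorphic function across the circle; in particular h' does not vanish there.
   Hence F' = (phi' o h) h' extends continuously and vanishes on the circle only where phi' o h does. *)

theory Submission
  imports Defs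
begin

section \<open>Annuli and their closures\<close>

lemma mem_annulus_0 [simp]: "z \<in> annulus 0 r s \<longleftrightarrow> r < norm z \<and> norm z < s"
  by (simp add: annulus_def)

lemma open_annulus_0: "open (annulus 0 r s)"
proof -
  have "annulus 0 r s = ball 0 s \<inter> - cball 0 r"
    by auto
  then show ?thesis
    by (metis open_Int open_ball open_Compl closed_cball)
qed

text \<open>Shrinking z radially to t * z with t slightly below 1 stays in the annulus once t > r /
  |z|, which reaches the outer circle and every point of modulus above r. Radial shrinking would
  leave the annulus at modulus r, so the inner circle appears only in the upper bound.\<close>

lemma closure_annulus_0:
  assumes "0 \<le> r" "r < s"
  shows "{z. r < norm z \<and> norm z \<le> s} \<subseteq> closure (annulus 0 r s)"
    and "closure (annulus 0 r s) \<subseteq> {z. r \<le> norm z \<and> norm z \<le> s}"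
proof -
  have "closed {z::complex. r \<le> norm z \<and> norm z \<le> s}"
    by (intro closed_Collect_conj closed_Collect_le continuous_intros)
  then show "closure (annulus 0 r s) \<subseteq> {z. r \<le> norm z \<and> norm z \<le> s}"
    by (rule closure_minimal[rotated]) auto
  show "{z. r < norm z \<and> norm z \<le> s} \<subseteq> closure (annulus 0 r s)"
  proof clarify
    fix z :: complex assume z: "r < norm z" "norm z \<le> s"
    have "((\<lambda>t::real. of_real t * z) \<longlongrightarrow> of_real 1 * z) (at_left 1)"
      by (intro tendsto_intros)
    moreover have "eventually (\<lambda>t::real. of_real t * z \<in> annulus 0 r s) (at_left 1)"
    proof -
      have "norm z > 0" using z assms by linarith
      then have "max 0 (r / norm z) < 1" using z by simp
      then have "eventually (\<lambda>t::real. t \<in> {max 0 (r / norm z)<..<1}) (at_left 1)"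
        by (rule eventually_at_leftI[rotated]) auto
      then show ?thesis
      proof eventually_elim
        case (elim t)
        then have "r < t * norm z" "t * norm z < norm z"
          using \<open>norm z > 0\<close> by (auto simp: field_simps)
        then show ?case using z elim by (auto simp: norm_mult)
      qed
    qed
    then have "eventually (\<lambda>t::real. of_real t * z \<in> closure (annulus 0 r s)) (at_left 1)"
      by (rule eventually_mono) (use closure_subset in blast)
    ultimately have "of_real 1 * z \<in> closure (annulus 0 r s)"
      by (intro Lim_in_closed_set[OF closed_closure]) auto
    then show "z \<in> closure (annulus 0 r s)" by simp
  qed
qed

section \<open>Reflection across the unit circle\<close>

text \<open>The exponential turns the unit circle into the imaginary axis, where the pasting lemma for
  lines applies; a branch of the logarithm transports the conclusion back.\<close>

lemma holomorphic_on_paste_across_circle: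
  fixes f :: "complex \<Rightarrow> complex"
  assumes "open S" and "continuous_on S f"
    and inside: "f holomorphic_on S \<inter> {z. norm z < 1}"
    and outside: "f holomorphic_on S \<inter> {z. 1 < norm z}"
  shows "f holomorphic_on S"
proof -
  define U where "U = exp -` S"
  have "open U"
    unfolding U_def using \<open>open S\<close> by (intro open_vimage continuous_intros)
  have G: "(f \<circ> exp) holomorphic_on U"
  \<comment> \<open>With direction 1 and offset 0 the line is Re z = 0, and |exp z| is below or
    above 1 according to the sign of Re z.\<close>
  proof (rule holomorphic_on_paste_across_line[of U 1 _ 0])
    show "(f \<circ> exp) holomorphic_on U \<inter> {z. 1 \<bullet> z < 0}"
      by (rule holomorphic_on_compose_gen[OF _ inside]) (auto intro: holomorphic_intros simp: U_def)
    show "(f \<circ> exp) holomorphic_on U \<inter> {z. 0 < 1 \<bullet> z}"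
      by (rule holomorphic_on_compose_gen[OF _ outside]) (auto intro: holomorphic_intros simp: U_def)
    show "continuous_on U (f \<circ> exp)"
      by (rule continuous_on_compose[OF _ continuous_on_subset[OF \<open>continuous_on S f\<close>]])
        (auto intro: continuous_intros simp: U_def)
  qed (use \<open>open U\<close> in auto)
  have "f field_differentiable at p" if "p \<in> S" for p
  proof (cases "norm p = 1")
    case False
    have op: "open (S \<inter> {z. norm z < 1})" "open (S \<inter> {z. 1 < norm z})"
      using \<open>open S\<close> by (auto intro!: open_Int open_Collect_less continuous_intros)
    from False consider "norm p < 1" | "1 < norm p" by linarith
    then show ?thesis
      using that inside outside op by cases (auto intro: holomorphic_on_imp_differentiable_at)
  next
    case True
    \<comment> \<open>Dividing by p turns the point into 1, and the right half-plane avoids the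
      branch cut of \<open>Ln\<close>. The summand \<open>Ln p\<close> is only a constant, so p may
      itself lie on the cut.\<close>
    define V where "V = S \<inter> {z. 0 < Re (z / p)}"
    have "p \<noteq> 0" using True by auto
    have "open V"
      unfolding V_def using \<open>open S\<close> \<open>p \<noteq> 0\<close>
      by (intro open_Int open_Collect_less continuous_intros) auto
    have exp_log: "exp (Ln (z / p) + Ln p) = z" if "z \<in> V" for z
    proof -
      have "z / p \<noteq> 0" using that by (auto simp: V_def)
      then show ?thesis using \<open>p \<noteq> 0\<close> by (simp add: exp_add)
    qed
    have "(f \<circ> exp \<circ> (\<lambda>z. Ln (z / p) + Ln p)) holomorphic_on V"
    proof (rule holomorphic_on_compose_gen[OF _ G])
      show "(\<lambda>z. Ln (z / p) + Ln p) holomorphic_on V"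
        using \<open>p \<noteq> 0\<close> by (intro holomorphic_intros) (auto simp: V_def complex_nonpos_Reals_iff)
      show "(\<lambda>z. Ln (z / p) + Ln p) ` V \<subseteq> U"
        using exp_log by (auto simp: U_def V_def)
    qed
    then have "f holomorphic_on V"
      by (rule holomorphic_transform) (simp add: exp_log)
    moreover have "p \<in> V" using that \<open>p \<noteq> 0\<close> by (simp add: V_def)
    ultimately show ?thesis
      using \<open>open V\<close> holomorphic_on_imp_differentiable_at by blast
  qed
  then show ?thesis
    using holomorphic_on_def field_differentiable_at_within by blast
qed

text \<open>Outside the disk, h is replaced by its conjugate under inversion in the unit circle.
  That inversion fixes the circle pointwise and h preserves the circle, so the two pieces match
  there. Nonvanishing of h keeps the reflected values finite.\<close>

lemma Schwarz_reflection_circle: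
  fixes h :: "complex \<Rightarrow> complex"
  assumes "0 < \<rho>"
    and cont: "continuous_on {z. \<rho> < norm z \<and> norm z \<le> 1} h"
    and hol: "h holomorphic_on annulus 0 \<rho> 1"
    and inj: "inj_on h {z. \<rho> < norm z \<and> norm z \<le> 1}"
    and inside: "\<And>z. \<lbrakk>\<rho> < norm z; norm z < 1\<rbrakk> \<Longrightarrow> norm (h z) < 1"
    and nz: "\<And>z. \<lbrakk>\<rho> < norm z; norm z \<le> 1\<rbrakk> \<Longrightarrow> h z \<noteq> 0"
    and circle: "\<And>z. norm z = 1 \<Longrightarrow> norm (h z) = 1"
  obtains H where "H holomorphic_on annulus 0 \<rho> (1/\<rho>)" "inj_on H (annulus 0 \<rho> (1/\<rho>))"
    "\<And>z. \<lbrakk>\<rho> < norm z; norm z \<le> 1\<rbrakk> \<Longrightarrow> H z = h z"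
proof
  define R where "R = (\<lambda>z. inverse (cnj z))"
  define k where "k = R \<circ> h \<circ> R"
  define H where "H = (\<lambda>z. if norm z \<le> 1 then h z else k z)"
  have RR [simp]: "R (R z) = z" for z
    by (simp add: R_def)
  have normR: "norm (R z) = 1 / norm z" for z
    by (simp add: R_def norm_inverse divide_inverse)
  have R_circle: "R z = z" if "norm z = 1" for z
    using that complex_norm_square[of z] unfolding R_def by (intro inverse_unique) (simp add: mult.commute)
  have R_range: "\<rho> < norm (R z) \<and> norm (R z) \<le> 1" if "1 \<le> norm z" "norm z < 1/\<rho>" for z
  proof -
    have "norm z > 0" using that by linarith
    then show ?thesis using that \<open>0 < \<rho>\<close> by (auto simp: normR field_simps)
  qed
  have R_range': "norm (R z) < 1" if "1 < norm z" for z
  proof -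
    have "norm z > 0" using that by linarith
    then show ?thesis using that by (simp add: normR field_simps)
  qed
  let ?S = "annulus 0 \<rho> (1/\<rho>)"
  have k_hol: "k holomorphic_on {z. 1 < norm z \<and> norm z < 1/\<rho>}" (is "_ holomorphic_on ?O")
  proof -
    have opO: "open ?O"
      by (intro open_Collect_conj open_Collect_less continuous_intros)
    \<comment> \<open>Each \<open>R\<close> is \<open>inverse\<close> composed with
      \<open>cnj\<close>. Grouping the factors this way leaves a holomorphic map between two
      conjugations, followed by one last inversion.\<close>
    have "(cnj \<circ> (h \<circ> inverse) \<circ> cnj) holomorphic_on ?O"
    proof (rule holomorphic_on_compose_cnj_cnj[OF _ opO])
      show "(h \<circ> inverse) holomorphic_on cnj ` ?O"
      proof (rule holomorphic_on_compose_gen[OF _ hol])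
        show "inverse holomorphic_on cnj ` ?O"
          by (intro holomorphic_on_inverse holomorphic_on_ident) auto
        show "inverse ` cnj ` ?O \<subseteq> annulus 0 \<rho> 1"
        proof clarify
          fix z :: complex assume z: "1 < norm z" "norm z < 1/\<rho>"
          then show "inverse (cnj z) \<in> annulus 0 \<rho> 1"
            using R_range[of z] R_range'[of z] by (simp add: R_def)
        qed
      qed
    qed
    then have "(\<lambda>z. inverse ((cnj \<circ> (h \<circ> inverse) \<circ> cnj) z)) holomorphic_on ?O"
    proof (rule holomorphic_on_inverse)
      fix z assume "z \<in> ?O"
      then have "h (R z) \<noteq> 0" using R_range[of z] nz[of "R z"] by auto
      then show "(cnj \<circ> (h \<circ> inverse) \<circ> cnj) z \<noteq> 0" by (simp add: R_def)
    qed
    then show ?thesis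
      by (rule holomorphic_transform) (simp add: k_def R_def)
  qed
  have k_cont: "continuous_on {z. 1 \<le> norm z \<and> norm z < 1/\<rho>} k"
  proof -
    have "continuous_on {z. 1 \<le> norm z \<and> norm z < 1/\<rho>} R"
      unfolding R_def by (intro continuous_intros) auto
    then have "continuous_on {z. 1 \<le> norm z \<and> norm z < 1/\<rho>} (\<lambda>z. h (R z))"
      by (rule continuous_on_compose2[OF cont]) (use R_range in auto)
    then have "continuous_on {z. 1 \<le> norm z \<and> norm z < 1/\<rho>} (\<lambda>z. inverse (cnj (h (R z))))"
      using nz R_range by (intro continuous_on_inverse continuous_on_cnj) auto
    moreover have "k = (\<lambda>z. inverse (cnj (h (R z))))"
      by (auto simp: k_def R_def)
    ultimately show ?thesis by simp
  qed
  have H_cont: "continuous_on ?S H"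
    unfolding H_def
  proof (rule continuous_on_cases_le)
    show "continuous_on {z \<in> ?S. norm z \<le> 1} h"
      by (rule continuous_on_subset[OF cont]) auto
    show "continuous_on {z \<in> ?S. 1 \<le> norm z} k"
      by (rule continuous_on_subset[OF k_cont]) auto
    show "h z = k z" if "norm z = 1" for z
      using that circle[of z] by (simp add: k_def R_circle)
  qed (intro continuous_intros)
  show "H holomorphic_on ?S"
  proof (rule holomorphic_on_paste_across_circle[OF open_annulus_0 H_cont])
    show "H holomorphic_on ?S \<inter> {z. norm z < 1}"
      by (rule holomorphic_transform[OF holomorphic_on_subset[OF hol]]) (auto simp: H_def)
    show "H holomorphic_on ?S \<inter> {z. 1 < norm z}"
      by (rule holomorphic_transform[OF holomorphic_on_subset[OF k_hol]]) (auto simp: H_def)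
  qed
  show "H z = h z" if "\<rho> < norm z" "norm z \<le> 1" for z
    using that by (simp add: H_def)
  \<comment> \<open>Values inside and on the circle have modulus at most 1, values outside have
    modulus above 1. Hence two points with equal image lie on the same side, where injectivity of
    \<open>h\<close> decides.\<close>
  have le: "norm (H z) \<le> 1" if "\<rho> < norm z" "norm z \<le> 1" for z
    using inside[of z] circle[of z] that by (cases "norm z = 1") (auto simp: H_def)
  have gt: "norm (H z) > 1" if "1 < norm z" "norm z < 1/\<rho>" for z
  proof -
    have "\<rho> < norm (R z)" "norm (R z) < 1"
      using R_range[of z] R_range'[of z] that by auto
    then have "norm (h (R z)) < 1" "h (R z) \<noteq> 0"
      using inside nz by auto
    then show ?thesis using that by (simp add: H_def k_def normR)
  qed
  show "inj_on H ?S"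
  proof (rule inj_onI)
    fix z w assume zw: "z \<in> ?S" "w \<in> ?S" "H z = H w"
    show "z = w"
    proof (cases "norm z \<le> 1")
      case True
      then have "norm w \<le> 1" using le[of z] gt[of w] zw by fastforce
      then show ?thesis using zw True inj by (auto simp: H_def inj_on_def)
    next
      case False
      then have w: "\<not> norm w \<le> 1" using le[of w] gt[of z] zw by fastforce
      then have "R (h (R z)) = R (h (R w))" using False zw by (simp add: H_def k_def)
      then have "h (R z) = h (R w)" by (metis RR)
      moreover have "R z \<in> {z. \<rho> < norm z \<and> norm z \<le> 1}" "R w \<in> {z. \<rho> < norm z \<and> norm z \<le> 1}"
        using R_range[of z] R_range[of w] zw(1,2) False w by simp_all
      ultimately have "R z = R w" by (rule inj_onD[OF inj])
      then show ?thesis by (metis RR)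
    qed
  qed
qed

theorem corollary2p4p2:
  fixes r :: real
    and \<phi> \<phi>' \<gamma> F :: "complex \<Rightarrow> complex"
    and W :: "complex set"
  assumes "0 < r" and "r < 1"
    and "continuous_on (closure (annulus 0 r 1)) \<phi>"
    and "inj_on \<phi> (closure (annulus 0 r 1))"
    and "\<phi> holomorphic_on annulus 0 r 1"
    and "continuous_extension (annulus 0 r 1) (deriv \<phi>) \<phi>'"
    and "\<And>\<theta>::real. \<gamma> (exp (\<i> * of_real \<theta>)) = \<phi> (exp (\<i> * of_real \<theta>))"
    and "is_interior_of W (\<gamma> ` sphere 0 1)"
    and "\<phi> ` annulus 0 r 1 \<subseteq> W"
    and "is_conformal_onto F (ball 0 1) W"
    and "\<exists>G. homeomorphism (cball 0 1) (closure W) F G"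
  shows "\<exists>F'. continuous_extension (ball 0 1) (deriv F) F' \<and>
           (\<forall>z. norm z = 1 \<and> \<phi>' z \<noteq> 0 \<longrightarrow>
             (\<forall>\<zeta>\<in>cball 0 1. F \<zeta> \<in> \<phi> ` closure (annulus 0 r 1) \<and>
                inv_into (closure (annulus 0 r 1)) \<phi> (F \<zeta>) = z \<longrightarrow> F' \<zeta> \<noteq> 0))"
proof -

  \<comment> \<open>The closed annulus, the curve J and boundary values of F\<close>
  define A where "A = annulus 0 r 1"
  define K where "K = closure A"
  define J where "J = \<phi> ` sphere 0 1"
  have "open A" by (simp add: A_def open_annulus_0)
  have memA: "z \<in> A \<longleftrightarrow> r < norm z \<and> norm z < 1" for z
    by (simp add: A_def)
  have "A \<subseteq> K" by (simp add: K_def closure_subset)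
  have in_K: "z \<in> K" if "r < norm z" "norm z \<le> 1" for z
    using closure_annulus_0(1)[of r 1] assms(1,2) that by (auto simp: K_def A_def)
  have K_bounds: "r \<le> norm z \<and> norm z \<le> 1" if "z \<in> K" for z
    using closure_annulus_0(2)[of r 1] assms(1,2) that by (auto simp: K_def A_def)
  have K_cases: "z \<in> A \<or> norm z = r \<or> norm z = 1" if "z \<in> K" for z
    using K_bounds[OF that] by (auto simp: memA)
  have sphere_K: "sphere 0 1 \<subseteq> K"
    using in_K \<open>r < 1\<close> by auto
  have "compact K"
    unfolding K_def A_def using bounded_subset[OF bounded_ball, of "annulus 0 r 1" 0 1]
    by (simp add: compact_closure subset_iff)
  note cont = assms(3)[folded A_def, folded K_def] and inj = assms(4)[folded A_def, folded K_def]
    and hol = assms(5)[folded A_def]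
  have \<phi>': "continuous_on K \<phi>'" "\<And>z. z \<in> A \<Longrightarrow> \<phi>' z = deriv \<phi> z"
    using assms(6) by (auto simp: continuous_extension_def A_def K_def)
  have inj_A: "inj_on \<phi> A"
    using inj \<open>A \<subseteq> K\<close> inj_on_subset by blast
  have "\<gamma> z = \<phi> z" if "norm z = 1" for z
  proof -
    have "z = exp (\<i> * of_real (Arg z))"
      using Arg_eq[of z] that by force
    then show ?thesis using assms(7) by metis
  qed
  then have "\<gamma> ` sphere 0 1 = J"
    unfolding J_def by (intro image_cong) auto
  then have W: "W \<in> components (- J)"
    using assms(8) by (simp add: is_interior_of_def)
  have "compact J"
    unfolding J_def by (intro compact_continuous_image continuous_on_subset[OF cont sphere_K] compact_sphere)
  then have "closed J" by (rule compact_imp_closed)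
  have "open W" using W \<open>closed J\<close> open_components by blast
  have WJ: "W \<inter> J = {}" using W in_components_subset by fastforce
  have clW: "closure W \<subseteq> W \<union> J"
    using frontier_of_components_closed_complement[OF \<open>closed J\<close> W] \<open>open W\<close>
    by (auto simp: frontier_def interior_open)
  have \<phi>W: "\<phi> ` A \<subseteq> W" using assms(9) by (simp add: A_def)
  have \<phi>K: "\<phi> ` K \<subseteq> closure W"
    unfolding K_def
    using image_closure_subset[of A \<phi> "closure W"] cont \<phi>W closure_subset[of W] K_def by blast
  have F: "F holomorphic_on ball 0 1" "inj_on F (ball 0 1)" "F ` ball 0 1 = W"
    using assms(10) by (auto simp: is_conformal_onto_def)
  obtain G where G: "homeomorphism (cball 0 1) (closure W) F G"
    using assms(11) by blast
  then have contF: "continuous_on (cball 0 1) F" and contG: "continuous_on (closure W) G"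
    and GF: "\<And>z. z \<in> cball 0 1 \<Longrightarrow> G (F z) = z" and FG: "\<And>w. w \<in> closure W \<Longrightarrow> F (G w) = w"
    and Fim: "F ` cball 0 1 = closure W" and Gim: "G ` closure W = cball 0 1"
    by (auto simp: homeomorphism_def)
  have injF: "inj_on F (cball 0 1)"
    using GF by (metis inj_onI)
  \<comment> \<open>A value in W is already taken in the open disk, so taking it on the circle as
    well would contradict injectivity on the closed disk.\<close>
  have F_circle: "F z \<in> J" if "norm z = 1" for z
  proof -
    have "F z \<notin> W"
    proof
      assume "F z \<in> W"
      then obtain y where "y \<in> ball 0 1" "F y = F z" using F(3) by (metis imageE)
      then have "y \<in> cball 0 1" "z \<in> cball 0 1" using that by auto
      with \<open>F y = F z\<close> have "y = z" by (rule inj_onD[OF injF])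
      then show False using \<open>y \<in> ball 0 1\<close> that by simp
    qed
    moreover have "F z \<in> closure W" using Fim that by auto
    ultimately show ?thesis using clW by auto
  qed
  have G_ball: "norm (G w) < 1" if "w \<in> W" for w
    using that GF F(3) by force

  \<comment> \<open>A collar of the unit circle mapped by F into the image of the annulus\<close>
  define C where "C = \<phi> ` (K \<inter> sphere 0 r)"
  \<comment> \<open>Intersecting with \<open>K\<close> keeps the set inside the domain on which
    \<phi> is known to be continuous and injective; \<open>closure_annulus_0\<close> leaves open
    which points of modulus r belong to \<open>K\<close>.\<close>
  have "compact C"
    unfolding C_def
    by (intro compact_continuous_image continuous_on_subset[OF cont] compact_Int_closed \<open>compact K\<close>) auto
  have CJ: "C \<inter> J = {}"
  proof -
    have False if "x \<in> K" "norm x = r" "norm y = 1" "\<phi> x = \<phi> y" for x y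
      using inj_onD[OF inj that(4)] that sphere_K \<open>r < 1\<close> by auto
    then show ?thesis by (force simp: C_def J_def)
  qed
  then have CW: "C \<subseteq> W"
    using \<phi>K clW by (auto simp: C_def)
  \<comment> \<open>By compactness |G| has a maximum m < 1 on C. Inserting 0 keeps the set nonempty
    and m nonnegative, so the midpoint of m and 1 lies strictly between 0 and 1 and strictly above
    every |G w|.\<close>
  obtain \<rho> where \<rho>: "0 < \<rho>" "\<rho> < 1" "\<And>w. w \<in> C \<Longrightarrow> norm (G w) < \<rho>"
  proof -
    have "compact (G ` C)"
      using \<open>compact C\<close> CW closure_subset[of W]
      by (intro compact_continuous_image continuous_on_subset[OF contG]) auto
    then have "compact (norm ` insert 0 (G ` C))"
      by (intro compact_continuous_image continuous_intros) (simp add: compact_insert)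
    then obtain m where m: "m \<in> norm ` insert 0 (G ` C)" "\<forall>y\<in>norm ` insert 0 (G ` C). y \<le> m"
      using compact_attains_sup by (metis (no_types, lifting) empty_iff image_is_empty insertI1)
    have "m < 1" "0 \<le> m" using m G_ball CW by auto
    then show thesis
      using m by (intro that[of "(m + 1) / 2"]) (auto intro: le_less_trans)
  qed
  define S where "S = annulus 0 \<rho> 1"
  have S_ball: "S \<subseteq> ball 0 1" by (auto simp: S_def)
  have "open S" by (simp add: S_def open_annulus_0)
  have F_S: "F ` S \<subseteq> \<phi> ` A"
  proof -
    define U where "U = S \<inter> F -` (\<phi> ` A)"
    have contFS: "continuous_on S F"
      using S_ball by (intro continuous_on_subset[OF contF]) (meson ball_subset_cball subset_trans)
    have "open (\<phi> ` A)"
      using open_mapping_thm3[OF hol \<open>open A\<close> inj_A] .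
    then have op: "openin (top_of_set S) U"
      unfolding U_def by (rule continuous_openin_preimage_gen[OF contFS])
    \<comment> \<open>Openness of \<phi>(A) makes U relatively open and compactness of \<phi>(K)
      makes it relatively closed. Both preimages agree on S because F(S) misses the images of the
      boundary circles: J lies outside W, and C pulls back into |z| < \<rho>.\<close>
    have "U = S \<inter> F -` (\<phi> ` K)"
    proof -
      have "F z \<in> \<phi> ` A" if "z \<in> S" "x \<in> K" "F z = \<phi> x" for z x
      proof -
        have "F z \<in> W" using that(1) S_ball F(3) by blast
        then have "\<phi> x \<notin> J" using WJ that(3) by auto
        then have "norm x \<noteq> 1" by (auto simp: J_def)
        moreover have "norm x \<noteq> r"
        proof
          assume "norm x = r"
          then have "F z \<in> C" using that by (auto simp: C_def)
          then have "norm (G (F z)) < \<rho>" by (rule \<rho>)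
          then show False using that(1) GF[of z] by (auto simp: S_def)
        qed
        ultimately show ?thesis using K_cases that by auto
      qed
      then show ?thesis using \<open>A \<subseteq> K\<close> by (auto simp: U_def)
    qed
    moreover have "closed (\<phi> ` K)"
      by (intro compact_imp_closed compact_continuous_image cont \<open>compact K\<close>)
    ultimately have cl: "closedin (top_of_set S) U"
      using continuous_closedin_preimage[OF contFS] by simp
    have "connected S"
      using connected_annulus(1)[of \<rho> "0::complex" 1] by (simp add: S_def annulus_def)
    \<comment> \<open>The point \<phi>(1) is on J, hence outside W, so G sends it to the unit
      circle. By continuity, points of A close to 1 are sent by G \<circ> \<phi> beyond radius
      \<rho>.\<close>
    moreover have "U \<noteq> {}"
    proof -
      have "1 \<in> K" using sphere_K by auto
      have "continuous_on K (\<lambda>z. norm (G (\<phi> z)))"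
        by (intro continuous_on_norm continuous_on_compose2[OF contG cont \<phi>K])
      then have "openin (top_of_set K) (K \<inter> (\<lambda>z. norm (G (\<phi> z))) -` {\<rho><..})"
        by (rule continuous_openin_preimage_gen) auto
      then obtain T where T: "open T" "K \<inter> (\<lambda>z. norm (G (\<phi> z))) -` {\<rho><..} = K \<inter> T"
        by (auto simp: openin_open)
      have "norm (G (\<phi> 1)) = 1"
      proof -
        have "\<phi> 1 \<in> closure W" using \<phi>K \<open>1 \<in> K\<close> by auto
        then have "norm (G (\<phi> 1)) \<le> 1" "F (G (\<phi> 1)) = \<phi> 1"
          using Gim FG by auto
        moreover have "\<phi> 1 \<notin> W" using WJ by (auto simp: J_def)
        ultimately show ?thesis using F(3) by (force simp: less_le)
      qed
      then have "1 \<in> T" using T \<open>1 \<in> K\<close> \<rho> by auto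
      then obtain x where x: "x \<in> A" "x \<in> T"
        using \<open>1 \<in> K\<close> \<open>open T\<close> unfolding K_def by (meson closure_iff_nhds_not_empty disjoint_iff subset_refl)
      then have "\<rho> < norm (G (\<phi> x))" using T \<open>A \<subseteq> K\<close> by auto
      moreover have "\<phi> x \<in> W" using \<phi>W x by auto
      ultimately have "G (\<phi> x) \<in> U"
        using G_ball FG[of "\<phi> x"] closure_subset[of W] x by (auto simp: U_def S_def)
      then show ?thesis by auto
    qed
    ultimately have "U = S"
      using op cl by (auto simp: connected_clopen)
    then show ?thesis by (auto simp: U_def)
  qed

  \<comment> \<open>The transition map h on the collar and its reflection\<close>
  define h where "h = (\<lambda>z. inv_into K \<phi> (F z))"
  define S' where "S' = {z::complex. \<rho> < norm z \<and> norm z \<le> 1}"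
  have "S' \<subseteq> cball 0 1" by (auto simp: S'_def)
  have F_S': "F z \<in> \<phi> ` K" if "z \<in> S'" for z
  proof (cases "norm z = 1")
    case True
    then show ?thesis using F_circle[of z] sphere_K by (auto simp: J_def)
  next
    case False
    then have "z \<in> S" using that by (auto simp: S_def S'_def)
    then show ?thesis using F_S \<open>A \<subseteq> K\<close> by auto
  qed
  have \<phi>h: "h z \<in> K" "\<phi> (h z) = F z" if "z \<in> S'" for z
    using F_S'[OF that] by (auto simp: h_def inv_into_into f_inv_into_f)
  have h_A: "h z \<in> A" if "z \<in> S" for z
  proof -
    from subsetD[OF F_S imageI[OF that]] obtain x where x: "F z = \<phi> x" "x \<in> A"
      by (rule imageE)
    have "h z = x" unfolding h_def x(1) by (rule inv_into_f_f[OF inj subsetD[OF \<open>A \<subseteq> K\<close> x(2)]])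
    with x show ?thesis by simp
  qed
  have h_circle: "norm (h z) = 1" if "norm z = 1" for z
  proof -
    from F_circle[OF that] obtain x where x: "F z = \<phi> x" "x \<in> sphere 0 1"
      unfolding J_def by (rule imageE)
    have "h z = x" unfolding h_def x(1) by (rule inv_into_f_f[OF inj subsetD[OF sphere_K x(2)]])
    with x show ?thesis by simp
  qed
  have h_cont: "continuous_on S' h"
    unfolding h_def
  proof (rule continuous_on_compose2[of "\<phi> ` K" "inv_into K \<phi>" S' F])
    show "continuous_on (\<phi> ` K) (inv_into K \<phi>)"
      by (rule continuous_on_inv[OF cont \<open>compact K\<close>]) (simp add: inj inv_into_f_f)
    show "continuous_on S' F"
      using continuous_on_subset[OF contF \<open>S' \<subseteq> cball 0 1\<close>] .
    show "F ` S' \<subseteq> \<phi> ` K"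
      using F_S' by (rule image_subsetI)
  qed
  have h_hol: "h holomorphic_on S"
  proof -
    \<comment> \<open>\<open>inv_into\<close> carries no holomorphy by itself; it is inherited from
      the holomorphic inverse of \<phi> on \<phi>(A), with which h agrees after composing with
      F.\<close>
    obtain g where g: "g holomorphic_on \<phi> ` A" "\<And>z. z \<in> A \<Longrightarrow> g (\<phi> z) = z"
      using holomorphic_has_inverse[OF hol \<open>open A\<close> inj_A] by metis
    have "(g \<circ> F) holomorphic_on S"
      by (rule holomorphic_on_compose_gen[OF holomorphic_on_subset[OF F(1) S_ball] g(1) F_S])
    moreover have "(g \<circ> F) z = h z" if "z \<in> S" for z
    proof -
      have "z \<in> S'" using that by (auto simp: S_def S'_def)
      then show ?thesis using g(2)[OF h_A[OF that]] \<phi>h[of z] by simp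
    qed
    ultimately show ?thesis by (rule holomorphic_transform)
  qed
  have h_inj: "inj_on h S'"
  proof (rule inj_onI)
    fix x y assume "x \<in> S'" "y \<in> S'" "h x = h y"
    then show "x = y"
      using \<phi>h(2)[of x] \<phi>h(2)[of y] injF \<open>S' \<subseteq> cball 0 1\<close> by (simp add: inj_on_def subset_iff)
  qed
  have h_lt: "norm (h z) < 1" if "\<rho> < norm z" "norm z < 1" for z
    using h_A[of z] that by (simp add: memA S_def)
  have h_nz: "h z \<noteq> 0" if "\<rho> < norm z" "norm z \<le> 1" for z
    using K_bounds[OF \<phi>h(1)[of z]] that \<open>0 < r\<close> by (auto simp: S'_def)
  obtain H where H: "H holomorphic_on annulus 0 \<rho> (1/\<rho>)" "inj_on H (annulus 0 \<rho> (1/\<rho>))"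
    and H_eq: "\<And>z. \<lbrakk>\<rho> < norm z; norm z \<le> 1\<rbrakk> \<Longrightarrow> H z = h z"
    using Schwarz_reflection_circle[OF \<rho>(1) h_cont[unfolded S'_def] h_hol[unfolded S_def]
        h_inj[unfolded S'_def] h_lt h_nz h_circle] by metis
  have S'_sub: "S' \<subseteq> annulus 0 \<rho> (1/\<rho>)"
  proof -
    have "1 < 1/\<rho>" using \<rho>(1,2) by simp
    then show ?thesis by (auto simp: S'_def intro: le_less_trans)
  qed
  have "S \<subseteq> S'" by (auto simp: S_def S'_def)
  then have S_sub: "S \<subseteq> annulus 0 \<rho> (1/\<rho>)" using S'_sub by (rule subset_trans)
  \<comment> \<open>The unit circle is interior to the domain of \<open>H\<close>, so injectivity
    excludes critical points there too. This is the gain from reflecting.\<close>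
  have H'_nz: "deriv H z \<noteq> 0" if "z \<in> S'" for z
    using holomorphic_injective_imp_regular[OF H(1) open_annulus_0 H(2)] S'_sub that by blast

  \<comment> \<open>The extension of the derivative of F\<close>
  define F' where "F' = (\<lambda>z. if norm z < 1 then deriv F z else \<phi>' (h z) * deriv H z)"
  \<comment> \<open>The definition makes agreement with \<open>deriv F\<close> in the open disk
    immediate. The product formula is the definition on the circle and the chain rule inside the
    collar, where H and h coincide on an open set and so have equal derivatives.\<close>
  have F'_eq: "F' z = \<phi>' (h z) * deriv H z" if "z \<in> S'" for z
  proof (cases "norm z < 1")
    case True
    then have "z \<in> S" using that by (auto simp: S_def S'_def)
    then have "h z \<in> A" by (rule h_A)
    have "deriv H z = deriv h z"
      by (rule complex_derivative_transform_within_open[OF _ h_hol \<open>open S\<close> \<open>z \<in> S\<close>])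
        (use H(1) S_sub holomorphic_on_subset in \<open>auto simp: S_def H_eq\<close>)
    moreover have "deriv F z = deriv (\<phi> \<circ> h) z"
    proof (rule complex_derivative_transform_within_open[OF _ _ \<open>open S\<close> \<open>z \<in> S\<close>])
      show "F holomorphic_on S" using F(1) S_ball holomorphic_on_subset by blast
      show "\<phi> \<circ> h holomorphic_on S"
        using h_A by (intro holomorphic_on_compose_gen[OF h_hol hol]) auto
      show "F w = (\<phi> \<circ> h) w" if "w \<in> S" for w
        using \<phi>h(2)[of w] that by (simp add: S_def S'_def)
    qed
    moreover have "deriv (\<phi> \<circ> h) z = deriv \<phi> (h z) * deriv h z"
      using h_hol hol \<open>open S\<close> \<open>open A\<close> \<open>z \<in> S\<close> \<open>h z \<in> A\<close>
      by (intro deriv_chain) (auto intro: holomorphic_on_imp_differentiable_at)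
    ultimately show ?thesis
      using True \<phi>'(2)[OF \<open>h z \<in> A\<close>] by (simp add: F'_def)
  qed (simp add: F'_def)
  have "continuous_on (cball 0 1) F'"
  proof -
    have "continuous_on S' (\<lambda>z. \<phi>' (h z) * deriv H z)"
      using \<phi>h(1) S'_sub holomorphic_on_subset[OF holomorphic_deriv[OF H(1) open_annulus_0] S'_sub]
      by (intro continuous_on_mult continuous_on_compose2[OF \<phi>'(1) h_cont])
        (auto intro: holomorphic_on_imp_continuous_on)
    then have "continuous_on S' F'"
      by (rule continuous_on_eq) (simp add: F'_eq)
    moreover have "continuous_on (ball 0 1) F'"
      by (rule continuous_on_eq[OF holomorphic_on_imp_continuous_on[OF holomorphic_deriv[OF F(1)]]])
        (auto simp: F'_def)
    \<comment> \<open>The open disk and the collar are both relatively open in the closed disk and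
      cover it, so continuity on each gives continuity on the whole.\<close>
    moreover have cb: "cball 0 1 = ball 0 1 \<union> S'"
      using \<rho> by (auto simp: S'_def)
    moreover have "openin (top_of_set (cball 0 1)) (ball (0::complex) 1)"
      by (metis Int_absorb1 ball_subset_cball openin_open_Int open_ball)
    moreover have "openin (top_of_set (cball 0 1)) S'"
    proof -
      have "S' = cball 0 1 \<inter> - cball 0 \<rho>" by (auto simp: S'_def)
      then show ?thesis by (metis openin_open_Int open_Compl closed_cball)
    qed
    ultimately show ?thesis
      by (metis continuous_on_Un_local_open)
  qed
  then have F'_ext: "continuous_extension (ball 0 1) (deriv F) F'"
    by (simp add: continuous_extension_def F'_def)
  have F'_nz: "F' \<zeta> \<noteq> 0"
    if z: "norm z = 1" "\<phi>' z \<noteq> 0" and \<zeta>: "\<zeta> \<in> cball 0 1" "F \<zeta> \<in> \<phi> ` K" "inv_into K \<phi> (F \<zeta>) = z"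
    for z \<zeta>
  proof -
    have "F \<zeta> = \<phi> z" using \<zeta>(2,3) f_inv_into_f by metis
    then have "F \<zeta> \<in> J" using z by (auto simp: J_def)
    \<comment> \<open>F sends the open disk into W, which is disjoint from J. So \<zeta> is on the
      circle, where the product formula has two nonzero factors.\<close>
    then have "\<zeta> \<notin> ball 0 1" using F(3) WJ by blast
    then have "\<zeta> \<in> S'" using \<zeta>(1) \<rho> by (auto simp: S'_def)
    then show ?thesis
      using F'_eq H'_nz z \<zeta>(3) by (simp add: h_def)
  qed
  show ?thesis
  proof (intro exI[of _ F'] conjI allI impI ballI)
    show "continuous_extension (ball 0 1) (deriv F) F'" by (rule F'_ext)
  qed (elim conjE, rule F'_nz[unfolded K_def A_def])
qed

end
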